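(* Let $D$ be a strongly connected digraph with $n\geq 4$ vertices in which every vertex has degree at least $\frac{n+1}{2}$. Then $D$ has a noncritical vertex.
   Context: Digraphs are finite, without loops and without multiple arcs: any two distinct vertices $x$ and $y$ are connected by at most two arcs, at most one in each direction (both arcs $xy$ and $yx$ may be present simultaneously). Two distinct vertices are adjacent if there is at least one arc between them, in either direction. A digraph is strongly connected if for any two of its vertices $x,y$ there is a directed path from $x$ to $y$. The degree $\deg(x)$ of a vertex $x$ in $D$ is the number of vertices adjacent to $x$; if $x$ and $y$ are connected by two arcs, then $y$ is counted once. $D-v$ denotes the digraph obtained from $D$ by deleting the vertex $v$ and all arcs incident to $v$. A vertex $v$ of a strongly connected digraph $D$ is called noncritical if the digraph $D-v$ is strongly connected. *)

theory Defs
  imports Complex_Main "Graph_Theory.Digraph_Component"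
begin

definition adjacent :: "('a, 'b) pre_digraph \<Rightarrow> 'a \<Rightarrow> 'a \<Rightarrow> bool" where
  "adjacent D x y \<longleftrightarrow>
     x \<in> verts D \<and> y \<in> verts D \<and> x \<noteq> y \<and> (x \<rightarrow>\<^bsub>D\<^esub> y \<or> y \<rightarrow>\<^bsub>D\<^esub> x)"

text \<open>Counts neighbours, not arcs: a vertex joined to \<open>x\<close> by two opposite arcs counts once,
  so this is in general smaller than \<open>in_degree D x + out_degree D x\<close>.\<close>
definition degree :: "('a, 'b) pre_digraph \<Rightarrow> 'a \<Rightarrow> nat" where
  "degree D x = card {y. adjacent D x y}"

definition noncritical :: "('a, 'b) pre_digraph \<Rightarrow> 'a \<Rightarrow> bool" where
  "noncritical D v \<longleftrightarrow>
     strongly_connected D \<and> v \<in> verts D \<and> strongly_connected (pre_digraph.del_vert D v)"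

end

theory Submission
  imports Defs
begin

text \<open>
  Suppose every vertex is critical. A maximal proper strong set \<open>H\<close> has a complement that is a
  path \<open>p\<^sub>1, \<dots>, p\<^sub>m\<close> with \<open>m \<ge> 2\<close>, entered from \<open>H\<close> only at \<open>p\<^sub>1\<close>, left towards \<open>H\<close> only at
  \<open>p\<^sub>m\<close>, and without forward shortcuts. If \<open>m \<ge> 3\<close>, then \<open>p\<^sub>2\<close> has at most \<open>m - 1\<close> neighbours, so by
  the degree condition \<open>H\<close> is small; for \<open>H\<close> of maximum size the backward arcs into \<open>p\<^sub>2\<close>
  close short cycles only, which contradicts the degree condition. Hence \<open>m = 2\<close> for some \<open>H\<close>, which
  yields a link: an arc \<open>ab\<close> that is the only arc leaving \<open>a\<close> and the only arc entering \<open>b\<close>.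

  Links are pairwise disjoint. If the second vertex of one link does not dominate the first vertex of
  another, then by counting at least three vertices outside all links join them, so all links stay
  in one strong component after the deletion of a vertex outside them (a single link lies on a
  triangle instead). Thus some proper strong set contains all links. Extend it to a maximal one \<open>H\<close>. It contains a second vertex
  \<open>g\<close> of a link and all but at most one of the neighbours of \<open>g\<close>, so \<open>H\<close> is large; this forces
  \<open>m = 2\<close> and gives a link outside \<open>H\<close>, a contradiction.
\<close>

section \<open>Strong vertex sets\<close>

text \<open>Walks must stay inside \<open>S\<close>, so this is strong connectivity of the induced
  subdigraph, except that the empty set also counts as strong.\<close>

definition strong_set :: "('a \<times> 'a) set \<Rightarrow> 'a set \<Rightarrow> bool" where
  "strong_set E S \<longleftrightarrow> (\<forall>x\<in>S. \<forall>y\<in>S. (x, y) \<in> (Restr E S)\<^sup>*)"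

lemma rtrancl_Restr_mono: "S \<subseteq> T \<Longrightarrow> (x, y) \<in> (Restr E S)\<^sup>* \<Longrightarrow> (x, y) \<in> (Restr E T)\<^sup>*"
  by (rule subsetD[OF rtrancl_mono, rotated]) auto

lemma strong_setI:
  assumes "\<And>u. u \<in> S \<Longrightarrow> (u, r) \<in> (Restr E S)\<^sup>*" "\<And>u. u \<in> S \<Longrightarrow> (r, u) \<in> (Restr E S)\<^sup>*"
  shows "strong_set E S"
  unfolding strong_set_def using assms by (meson rtrancl_trans)

lemma rtrancl_chain:
  assumes "i \<le> j" "\<And>k. i \<le> k \<Longrightarrow> k < j \<Longrightarrow> (p k, p (Suc k)) \<in> r"
  shows "(p i, p j) \<in> r\<^sup>*"
  using assms by (induction rule: dec_induct) (auto intro: rtrancl_into_rtrancl)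

section \<open>Ears and the complement of a maximal strong set\<close>

locale strong_relation =
  fixes V :: "'a set" and E :: "('a \<times> 'a) set"
  assumes finite_V: "finite V"
    and E_sub: "E \<subseteq> V \<times> V"
    and irrefl_E: "(x, x) \<notin> E"
    and strong_V: "strong_set E V"
begin

text \<open>Inner vertices may repeat and the two ends may coincide, so cutting out a piece of an
  ear needs no distinctness check; a shortest ear turns out to be injective anyway.\<close>

definition ear :: "'a set \<Rightarrow> (nat \<Rightarrow> 'a) \<Rightarrow> nat \<Rightarrow> bool" where
  "ear H p m \<longleftrightarrow> m \<ge> 1 \<and> p 0 \<in> H \<and> p (Suc m) \<in> H \<and> (\<forall>i\<in>{1..m}. p i \<in> V - H) \<and>
     (\<forall>i\<le>m. (p i, p (Suc i)) \<in> E)"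

definition maximal_strong :: "'a set \<Rightarrow> bool" where
  "maximal_strong H \<longleftrightarrow> strong_set E H \<and> H \<noteq> {} \<and> H \<subset> V \<and>
     (\<forall>S. strong_set E S \<longrightarrow> H \<subset> S \<longrightarrow> S \<subseteq> V \<longrightarrow> S = V)"

definition return_path :: "'a set \<Rightarrow> (nat \<Rightarrow> 'a) \<Rightarrow> nat \<Rightarrow> bool" where
  "return_path H p m \<longleftrightarrow> m \<ge> 1 \<and> inj_on p {1..m} \<and> V - H = p ` {1..m} \<and>
     (\<forall>i. 1 \<le> i \<longrightarrow> i < m \<longrightarrow> (p i, p (Suc i)) \<in> E) \<and>
     (\<forall>i\<in>{1..m}. \<forall>j\<in>{1..m}. (p i, p j) \<in> E \<longrightarrow> j \<le> Suc i) \<and>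
     (\<forall>i\<in>{1..m}. \<forall>h\<in>H. (h, p i) \<in> E \<longrightarrow> i = 1) \<and>
     (\<forall>i\<in>{1..m}. \<forall>h\<in>H. (p i, h) \<in> E \<longrightarrow> i = m)"

lemma return_pathD:
  assumes "return_path H p m"
  shows "m \<ge> 1" "inj_on p {1..m}" "V - H = p ` {1..m}"
    "1 \<le> i \<Longrightarrow> i < m \<Longrightarrow> (p i, p (Suc i)) \<in> E"
    "i \<in> {1..m} \<Longrightarrow> j \<in> {1..m} \<Longrightarrow> (p i, p j) \<in> E \<Longrightarrow> j \<le> Suc i"
    "i \<in> {1..m} \<Longrightarrow> h \<in> H \<Longrightarrow> (h, p i) \<in> E \<Longrightarrow> i = 1"
    "i \<in> {1..m} \<Longrightarrow> h \<in> H \<Longrightarrow> (p i, h) \<in> E \<Longrightarrow> i = m"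
  using assms unfolding return_path_def by blast+

definition nbrs :: "'a \<Rightarrow> 'a set" where
  "nbrs x = {y. (x, y) \<in> E \<or> (y, x) \<in> E}"

lemma nbrs_sub: "nbrs x \<subseteq> V - {x}"
  using E_sub irrefl_E by (auto simp: nbrs_def)

lemma finite_nbrs: "finite (nbrs x)"
  using nbrs_sub finite_V by (meson finite_Diff finite_subset)

text \<open>Every inner vertex is reached from \<open>p 0\<close> along the ear and runs on to
  \<open>p (Suc m)\<close>, from where \<open>H\<close> leads back to \<open>p 0\<close>.\<close>

lemma ear_strong:
  assumes "strong_set E H" "ear H p m"
  shows "strong_set E (H \<union> p ` {1..m})" (is "strong_set E ?S")
proof -
  have e: "m \<ge> 1" "p 0 \<in> H" "p (Suc m) \<in> H" "\<And>i. i \<le> m \<Longrightarrow> (p i, p (Suc i)) \<in> E"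
    using assms(2) by (auto simp: ear_def)
  have S: "p k \<in> ?S" if "k \<le> Suc m" for k
    using that e by (cases "k = 0"; cases "k = Suc m") auto
  have chain: "(p i, p j) \<in> (Restr E ?S)\<^sup>*" if "i \<le> j" "j \<le> Suc m" for i j
  proof (rule rtrancl_chain[OF that(1)])
    fix k assume "i \<le> k" "k < j"
    then show "(p k, p (Suc k)) \<in> Restr E ?S"
      using that(2) e(4)[of k] S[of k] S[of "Suc k"] by auto
  qed
  have H: "(x, y) \<in> (Restr E ?S)\<^sup>*" if "x \<in> H" "y \<in> H" for x y
  proof -
    have "(x, y) \<in> (Restr E H)\<^sup>*" using assms(1) that by (auto simp: strong_set_def)
    then show ?thesis by (rule rtrancl_Restr_mono[rotated]) simp
  qed
  show ?thesis
  proof (rule strong_setI[where r = "p 0"])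
    fix u assume u: "u \<in> ?S"
    show "(u, p 0) \<in> (Restr E ?S)\<^sup>*"
    proof (cases "u \<in> H")
      case False
      then obtain i where "i \<le> m" "u = p i" using u by auto
      then have "(u, p (Suc m)) \<in> (Restr E ?S)\<^sup>*" using chain[of i "Suc m"] by simp
      then show ?thesis using H[OF e(3) e(2)] by (rule rtrancl_trans)
    qed (use H e in blast)
    show "(p 0, u) \<in> (Restr E ?S)\<^sup>*"
    proof (cases "u \<in> H")
      case False
      then obtain i where "i \<le> m" "u = p i" using u by auto
      then show ?thesis using chain[of 0 i] by simp
    qed (use H e in blast)
  qed
qed

text \<open>Strong connectivity provides an arc leaving \<open>H\<close> and a walk from its head
  back to \<open>H\<close>; the walk is cut at its first vertex in \<open>H\<close>.\<close>

lemma ear_exists: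
  assumes "H \<noteq> {}" "H \<subset> V"
  shows "\<exists>p m. ear H p m"
proof -
  obtain h z where hz: "h \<in> H" "z \<in> V - H" using assms by auto
  have reach: "(x, y) \<in> E\<^sup>*" if "x \<in> V" "y \<in> V" for x y
    using strong_V that rtrancl_mono[of "Restr E V" E] by (auto simp: strong_set_def)
  have "(h, z) \<in> E\<^sup>*" "z \<notin> H" using reach hz assms by auto
  then have "\<exists>x\<in>H. \<exists>a\<in>-H. (x, a) \<in> E"
    by (induction rule: rtrancl_induct) (use hz in blast)+
  then obtain x a where xa: "x \<in> H" "a \<notin> H" "(x, a) \<in> E" by auto
  then have "(a, h) \<in> E\<^sup>*" using reach hz assms E_sub by auto
  then obtain n f where f: "f 0 = a" "f n = h" "\<And>i. i < n \<Longrightarrow> (f i, f (Suc i)) \<in> E"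
    unfolding rtrancl_power relpow_fun_conv by auto
  define k where "k = (LEAST k. f k \<in> H)"
  have k: "f k \<in> H" unfolding k_def by (rule LeastI[of _ n]) (simp add: f hz)
  have kn: "k \<le> n" unfolding k_def by (rule Least_le) (simp add: f hz)
  have less: "f i \<notin> H" if "i < k" for i using that not_less_Least unfolding k_def by blast
  have k0: "k \<noteq> 0" using k f xa by (metis)
  have fV: "f i \<in> V" if "i < k" for i using f(3)[of i] that kn E_sub by auto
  \<comment> \<open>\<open>case_nat x f\<close> puts \<open>x\<close> in front of the walk, so
    positions 1 to \<open>k\<close> hold \<open>f 0\<close> to \<open>f (k - 1)\<close>.\<close>
  have "ear H (case_nat x f) k"
    unfolding ear_def
  proof (intro conjI ballI allI impI)
    show "case_nat x f i \<in> V - H" if "i \<in> {1..k}" for i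
      using that less fV by (cases i) auto
    show "(case_nat x f i, case_nat x f (Suc i)) \<in> E" if "i \<le> k" for i
      using that xa f kn by (cases i) auto
  qed (use k0 xa k in auto)
  then show ?thesis by blast
qed

text \<open>Adding an ear to a maximal strong set exhausts \<open>V\<close>, so a shortest ear has no shortcuts.\<close>

lemma maximal_strong_complement:
  assumes "maximal_strong H"
  shows "\<exists>p m. return_path H p m"
proof -
  have H: "strong_set E H" "H \<noteq> {}" "H \<subset> V" using assms by (auto simp: maximal_strong_def)
  define m where "m = (LEAST m. \<exists>p. ear H p m)"
  obtain p where p: "ear H p m"
    using ear_exists[OF H(2,3)] LeastI_ex[of "\<lambda>m. \<exists>p. ear H p m"] unfolding m_def by auto
  have least: "m \<le> m'" if "ear H q m'" for q m' unfolding m_def by (rule Least_le) (use that in auto)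
  have e: "m \<ge> 1" "p 0 \<in> H" "p (Suc m) \<in> H" "\<And>i. i \<in> {1..m} \<Longrightarrow> p i \<in> V - H"
    "\<And>i. i \<le> m \<Longrightarrow> (p i, p (Suc i)) \<in> E"
    using p by (auto simp: ear_def)
  \<comment> \<open>Skipping the positions strictly between \<open>i\<close> and \<open>j\<close>
    would leave a shorter ear. The case \<open>j = Suc m\<close> is included.\<close>
  have shortcut: "j \<le> Suc i" if ij: "1 \<le> i" "i \<le> m" "j \<le> Suc m" "(p i, p j) \<in> E" for i j
  proof (rule ccontr)
    assume "\<not> j \<le> Suc i"
    then have lt: "Suc i < j" by simp
    define q where "q k = (if k \<le> i then p k else p (k + (j - Suc i)))" for k
    have "ear H q (m - (j - Suc i))"
      unfolding ear_def
    proof (intro conjI ballI allI impI)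
      show "1 \<le> m - (j - Suc i)" using ij lt by linarith
      show "q 0 \<in> H" using e by (simp add: q_def)
      show "q (Suc (m - (j - Suc i))) \<in> H" using e ij lt by (auto simp: q_def)
      fix k assume "k \<in> {1..m - (j - Suc i)}"
      then have "1 \<le> k" "k + (j - Suc i) \<le> m" using ij lt by auto
      then show "q k \<in> V - H" using e(4)[of k] e(4)[of "k + (j - Suc i)"] by (simp add: q_def)
    next
      fix k assume k: "k \<le> m - (j - Suc i)"
      consider "k < i" | "k = i" | "k > i" by linarith
      then show "(q k, q (Suc k)) \<in> E"
      proof cases
        case 1 then show ?thesis using e(5)[of k] ij by (auto simp: q_def)
      next
        case 2 then show ?thesis using ij lt by (auto simp: q_def)
      next
        case 3
        then have "k + (j - Suc i) \<le> m" using k by linarith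
        then show ?thesis using 3 e(5)[of "k + (j - Suc i)"] by (auto simp: q_def)
      qed
    qed
    from least[OF this] show False using ij lt by linarith
  qed
  have "return_path H p m"
    unfolding return_path_def
  proof (intro conjI allI ballI impI)
    show "m \<ge> 1" by (rule e)
    show "inj_on p {1..m}"
    proof (rule linorder_inj_onI')
      fix i j assume ij: "i \<in> {1..m}" "j \<in> {1..m}" "i < j"
      show "p i \<noteq> p j"
      proof
        assume "p i = p j"
        then have "(p i, p (Suc j)) \<in> E" using e(5)[of j] ij by auto
        then show False using shortcut[of i "Suc j"] ij by auto
      qed
    qed
    have "H \<union> p ` {1..m} = V"
    proof -
      have "H \<subset> H \<union> p ` {1..m}" using e(1) e(4)[of 1] by auto
      moreover have "H \<union> p ` {1..m} \<subseteq> V" using e(4) H by auto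
      ultimately show ?thesis using assms ear_strong[OF H(1) p] by (auto simp: maximal_strong_def)
    qed
    then show "V - H = p ` {1..m}" using e(4) by auto
    show "(p i, p (Suc i)) \<in> E" if "1 \<le> i" "i < m" for i using e(5) that by auto
    show "j \<le> Suc i" if "i \<in> {1..m}" "j \<in> {1..m}" "(p i, p j) \<in> E" for i j
      using shortcut[of i j] that by auto
    show "i = m" if "i \<in> {1..m}" "h \<in> H" "(p i, h) \<in> E" for h i
    proof -
      \<comment> \<open>Returning to \<open>H\<close> directly from \<open>p i\<close> ends the ear
        after \<open>i\<close> inner vertices.\<close>
      have "ear H (p(Suc i := h)) i" using that e by (auto simp: ear_def)
      from least[OF this] show ?thesis using that by auto
    qed
    show "i = 1" if "i \<in> {1..m}" "h \<in> H" "(h, p i) \<in> E" for h i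
    proof -
      \<comment> \<open>Entering directly at \<open>p i\<close> drops the first \<open>i - 1\<close>
        inner vertices.\<close>
      define q where "q k = (if k = 0 then h else p (k + (i - 1)))" for k
      have "ear H q (m - (i - 1))"
        unfolding ear_def
      proof (intro conjI ballI allI impI)
        show "(q k, q (Suc k)) \<in> E" if "k \<le> m - (i - 1)" for k
          using that \<open>i \<in> {1..m}\<close> \<open>(h, p i) \<in> E\<close> e(5)[of "k + (i - 1)"] by (auto simp: q_def)
        show "q k \<in> V - H" if "k \<in> {1..m - (i - 1)}" for k
        proof -
          have "1 \<le> k" "k + (i - 1) \<le> m" using that \<open>i \<in> {1..m}\<close> by auto
          then show ?thesis using e(4)[of "k + (i - 1)"] by (simp add: q_def)
        qed
      qed (use that e in \<open>auto simp: q_def\<close>)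
      from least[OF this] show ?thesis using that by auto
    qed
  qed
  then show ?thesis by blast
qed

lemma maximal_strong_extend:
  assumes "strong_set E S" "S \<noteq> {}" "S \<subset> V"
  shows "\<exists>H. maximal_strong H \<and> S \<subseteq> H"
proof -
  let ?P = "\<lambda>T. S \<subseteq> T \<and> strong_set E T \<and> T \<subset> V"
  have "\<exists>H. ?P H \<and> (\<forall>T. ?P T \<longrightarrow> card T \<le> card H)"
    by (rule ex_has_greatest_nat[of ?P S card "card V"])
      (use assms finite_V in \<open>blast intro: psubset_card_mono\<close>)+
  then obtain H where H: "?P H" "\<And>T. ?P T \<Longrightarrow> card T \<le> card H" by blast
  have "T = V" if "strong_set E T" "H \<subset> T" "T \<subseteq> V" for T
  proof (rule ccontr)
    assume "T \<noteq> V"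
    then have "card T \<le> card H" using H that by blast
    moreover have "card H < card T" using that finite_V by (meson finite_subset psubset_card_mono)
    ultimately show False by simp
  qed
  then have "maximal_strong H" using H(1) assms by (auto simp: maximal_strong_def)
  then show ?thesis using H(1) by blast
qed

end

section \<open>Existence of a link in a counterexample\<close>

locale critical_relation = strong_relation +
  assumes card_V: "card V \<ge> 4"
    and degree_V: "x \<in> V \<Longrightarrow> card V + 1 \<le> 2 * card (nbrs x)"
    and critical: "v \<in> V \<Longrightarrow> \<not> strong_set E (V - {v})"
begin

definition link :: "'a \<Rightarrow> 'a \<Rightarrow> bool" where
  "link a b \<longleftrightarrow> E `` {a} = {b} \<and> E\<inverse> `` {b} = {a}"

text \<open>The case \<open>m = 1\<close> contradicts criticality. If \<open>m \<ge> 3\<close>, then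
  \<open>p 2\<close> has no neighbour in \<open>H\<close>, hence at most \<open>m - 1\<close> in
  all, and the degree condition gives \<open>m \<ge> card H + 3\<close>, against
  \<open>large\<close>. So \<open>m = 2\<close>, and \<open>p 1\<close>, \<open>p 2\<close> form the
  link.\<close>

lemma link_outside:
  assumes H: "maximal_strong H" and large: "card V \<le> 2 * card H + 2"
  shows "\<exists>a b. link a b \<and> a \<notin> H"
proof -
  obtain p m where "return_path H p m" using maximal_strong_complement[OF H] by blast
  note p = return_pathD[OF this]
  have HV: "H \<subseteq> V" "finite H" "strong_set E H"
    using H finite_V by (auto simp: maximal_strong_def intro: finite_subset)
  have m: "card H + m = card V"
  proof -
    have "card (V - H) = m" using p(2,3) by (simp add: card_image)
    then show ?thesis using HV finite_V by (metis card_Diff_subset card_mono le_add_diff_inverse)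
  qed
  have "m \<noteq> 1"
  proof
    assume "m = 1"
    then have "V - H = {p 1}" using p(3) by simp
    then have "H = V - {p 1}" "p 1 \<in> V" using HV by auto
    then show False using critical HV by auto
  qed
  moreover have "\<not> m \<ge> 3"
  proof
    assume m3: "m \<ge> 3"
    have "p 2 \<in> V - H" using m3 unfolding p(3) by (intro imageI) simp
    moreover have "nbrs (p 2) \<inter> H = {}"
      using p(6)[of 2] p(7)[of 2] m3 by (auto simp: nbrs_def)
    ultimately have "nbrs (p 2) \<subseteq> V - H - {p 2}" using nbrs_sub by blast
    then have "card (nbrs (p 2)) \<le> card (V - H - {p 2})" using finite_V by (intro card_mono) auto
    also have "\<dots> = m - 1" using \<open>p 2 \<in> V - H\<close> p(2,3) by (simp add: card_image)
    finally show False using degree_V[of "p 2"] \<open>p 2 \<in> V - H\<close> m m3 large by simp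
  qed
  ultimately have m2: "m = 2" using p(1) by simp
  then have V: "V - H = {p 1, p 2}" using p(3) by (auto simp: numeral_2_eq_2 atLeastAtMostSuc_conv)
  have "link (p 1) (p 2)"
    unfolding link_def
  proof (intro conjI equalityI subsetI)
    fix y assume "y \<in> E `` {p 1}"
    then have y: "(p 1, y) \<in> E" "y \<in> V" "y \<noteq> p 1" using E_sub irrefl_E by auto
    then have "y \<notin> H" using p(7)[of 1 y] m2 by auto
    then show "y \<in> {p 2}" using y V by auto
  next
    fix y assume "y \<in> E\<inverse> `` {p 2}"
    then have y: "(y, p 2) \<in> E" "y \<in> V" "y \<noteq> p 2" using E_sub irrefl_E by auto
    then have "y \<notin> H" using p(6)[of 2 y] m2 by auto
    then show "y \<in> {p 1}" using y V by auto
  qed (use p(4)[of 1] m2 in \<open>auto simp: numeral_2_eq_2\<close>)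
  then show ?thesis using V by blast
qed

lemma large_maximal_strong: "\<exists>H. maximal_strong H \<and> card V \<le> 2 * card H + 2"
proof -
  let ?P = "\<lambda>T. T \<noteq> {} \<and> strong_set E T \<and> T \<subset> V"
  obtain v where v: "v \<in> V" using card_V by fastforce
  have "?P {v}" using v card_V by (auto simp: strong_set_def)
  then have "\<exists>H. ?P H \<and> (\<forall>T. ?P T \<longrightarrow> card T \<le> card H)"
    by (rule ex_has_greatest_nat[of ?P "{v}" card "card V"])
      (use finite_V in \<open>blast intro: psubset_card_mono\<close>)
  then obtain H where PH: "?P H" and max: "\<And>T. ?P T \<Longrightarrow> card T \<le> card H" by blast
  \<comment> \<open>A proper strong set of greatest size coincides with every maximal strong set
    that contains it.\<close>
  then obtain H' where H': "maximal_strong H'" "H \<subseteq> H'" using maximal_strong_extend by blast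
  have "finite H'" using H' finite_V by (auto simp: maximal_strong_def intro: finite_subset)
  moreover have "card H' \<le> card H" using max H' by (auto simp: maximal_strong_def)
  ultimately have H: "maximal_strong H" using H' card_seteq by metis
  obtain p m where "return_path H p m" using maximal_strong_complement[OF H] by blast
  note p = return_pathD[OF this]
  have HV: "H \<subset> V" "H \<noteq> {}" "finite H" using PH finite_V by (auto intro: finite_subset)
  have "card (V - H) = m" using p(2,3) by (simp add: card_image)
  then have m: "card H + m = card V"
    using HV finite_V by (metis card_Diff_subset card_mono le_add_diff_inverse psubset_imp_subset)
  have "card V \<le> 2 * card H + 2"
  proof (rule ccontr)
    assume small: "\<not> card V \<le> 2 * card H + 2"
    have m3: "m \<ge> 3" using small m by linarith
    have pV: "p i \<in> V - H" if "i \<in> {1..m}" for i using that p(3) by blast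
    \<comment> \<open>The arc from \<open>p j\<close> back to \<open>p 2\<close> closes a cycle on
      \<open>j - 1\<close> vertices, a proper strong set, which cannot be larger than
      \<open>H\<close>.\<close>
    have cycle: "j \<le> card H + 1" if j: "j \<in> {4..m}" "(p j, p 2) \<in> E" for j
    proof -
      let ?C = "p ` {2..j}"
      have chain: "(p i, p k) \<in> (Restr E ?C)\<^sup>*" if "2 \<le> i" "i \<le> k" "k \<le> j" for i k
        
      proof (rule rtrancl_chain[OF that(2)])
        fix l assume "i \<le> l" "l < k"
        then show "(p l, p (Suc l)) \<in> Restr E ?C" using that p(4)[of l] j by auto
      qed
      have "strong_set E ?C"
      proof (rule strong_setI[where r = "p 2"])
        fix u assume "u \<in> ?C"
        then obtain i where i: "u = p i" "2 \<le> i" "i \<le> j" by auto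
        show "(p 2, u) \<in> (Restr E ?C)\<^sup>*" using chain[of 2 i] i by simp
        have "(p j, p 2) \<in> Restr E ?C" using j by auto
        then show "(u, p 2) \<in> (Restr E ?C)\<^sup>*"
          using chain[of i j] i by (auto intro: rtrancl_into_rtrancl)
      qed
      moreover have "?C \<subseteq> V - H"
      proof (rule image_subsetI)
        show "p i \<in> V - H" if "i \<in> {2..j}" for i using that j by (intro pV) auto
      qed
      then have "?C \<subset> V" using HV by blast
      moreover have "?C \<noteq> {}" using j by auto
      ultimately have "card ?C \<le> card H" by (intro max conjI)
      moreover have "inj_on p {2..j}" by (rule inj_on_subset[OF p(2)]) (use j in auto)
      then have "card ?C = j - 1" by (simp add: card_image)
      ultimately show ?thesis by linarith
    qed
    have "nbrs (p 2) \<subseteq> {p 1, p 3} \<union> p ` {4..card H + 1}"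
    proof
      fix y assume y: "y \<in> nbrs (p 2)"
      have "y \<notin> H" using y p(6)[of 2 y] p(7)[of 2 y] m3 by (auto simp: nbrs_def)
      then obtain j where j: "y = p j" "j \<in> {1..m}" using y nbrs_sub p(3) by blast
      have "j \<noteq> 2" using y j nbrs_sub by blast
      then consider "j = 1" | "j = 3" | "j \<ge> 4" using j by force
      then show "y \<in> {p 1, p 3} \<union> p ` {4..card H + 1}"
      proof cases
        case 3
        then have "(p 2, p j) \<notin> E" using p(5)[of 2 j] j m3 by auto
        then have "(p j, p 2) \<in> E" using y j by (simp add: nbrs_def)
        then show ?thesis using cycle[of j] j 3 by simp
      qed (use j in auto)
    qed
    then have "card (nbrs (p 2)) \<le> card ({p 1, p 3} \<union> p ` {4..card H + 1})" by (intro card_mono) auto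
    also have "\<dots> \<le> card {p 1, p 3} + card (p ` {4..card H + 1})" by (rule card_Un_le)
    \<comment> \<open>The subtraction is truncated: for \<open>card H = 1\<close> the bound is 2,
      which is below the degree forced by \<open>card V \<ge> 4\<close>.\<close>
    also have "\<dots> \<le> 2 + (card H - 2)"
      using card_image_le[of "{4..card H + 1}" p] card_insert_le_m1[of 2 "{p 3}" "p 1"] by simp
    finally show False using degree_V[of "p 2"] pV[of 2] m3 small card_V by auto
  qed
  then show ?thesis using H by blast
qed

section \<open>The system of all links and its neighbourhoods\<close>

definition links :: "('a \<times> 'a) set" where "links = {(a, b). link a b}"
definition firsts :: "'a set" where "firsts = fst ` links"
definition seconds :: "'a set" where "seconds = snd ` links"
definition rest :: "'a set" where "rest = V - firsts - seconds"

lemma firstsE: assumes "a \<in> firsts" obtains b where "link a b" "b \<in> seconds"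
  using assms by (force simp: firsts_def seconds_def links_def)

lemma secondsE: assumes "b \<in> seconds" obtains a where "link a b" "a \<in> firsts"
  using assms by (force simp: firsts_def seconds_def links_def)

lemma linkD:
  assumes "link a b"
  shows "(a, b) \<in> E" "(a, y) \<in> E \<Longrightarrow> y = b" "(x, b) \<in> E \<Longrightarrow> x = a"
    "a \<in> firsts" "b \<in> seconds" "a \<in> V" "b \<in> V"
  using assms E_sub by (force simp: link_def firsts_def seconds_def links_def)+

lemma links_nonempty: "links \<noteq> {}"
  using large_maximal_strong link_outside unfolding links_def by blast

lemma firsts_seconds_sub: "firsts \<subseteq> V" "seconds \<subseteq> V"
  using linkD(6,7) by (auto simp: firsts_def seconds_def links_def)

text \<open>A vertex ending one link and starting another has a single in-neighbour and a single
  out-neighbour, but four or more vertices force degree at least 3.\<close>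

lemma firsts_seconds_disjoint: "firsts \<inter> seconds = {}"
proof (rule ccontr)
  assume "firsts \<inter> seconds \<noteq> {}"
  then obtain x where x: "x \<in> firsts" "x \<in> seconds" by auto
  obtain b where b: "link x b" using x(1) by (rule firstsE)
  obtain a where a: "link a x" using x(2) by (rule secondsE)
  then have "nbrs x \<subseteq> {a, b}" using linkD(2)[OF b] linkD(3)[OF a] by (auto simp: nbrs_def)
  then have "card (nbrs x) \<le> card {a, b}" by (intro card_mono) auto
  also have "\<dots> \<le> 2" by (simp add: card_insert_if)
  finally show False using degree_V[of x] card_V linkD(6)[OF b] by simp
qed

lemma card_seconds: "card seconds = card firsts"
proof -
  have "inj_on fst links" "inj_on snd links"
    using linkD(1,2,3) by (auto simp: inj_on_def links_def)
  then show ?thesis by (simp add: firsts_def seconds_def card_image)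
qed

lemma card_rest: "card rest + 2 * card firsts = card V"
proof -
  have fin: "finite firsts" "finite seconds" using firsts_seconds_sub finite_V finite_subset by auto
  have "card V = card (rest \<union> (firsts \<union> seconds))"
    using firsts_seconds_sub by (intro arg_cong[of _ _ card]) (auto simp: rest_def)
  also have "\<dots> = card rest + card (firsts \<union> seconds)"
    by (rule card_Un_disjoint) (use fin finite_V in \<open>auto simp: rest_def\<close>)
  also have "card (firsts \<union> seconds) = card firsts + card seconds"
    using fin firsts_seconds_disjoint by (rule card_Un_disjoint)
  finally show ?thesis by (simp add: card_seconds)
qed

text \<open>Any arc leaving a first vertex ends in a second one, so an arc between two first
  vertices would violate disjointness; dually for second vertices.\<close>

lemma nbrs_first: "p \<in> firsts \<Longrightarrow> nbrs p \<subseteq> seconds \<union> rest"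
  and nbrs_second: "g \<in> seconds \<Longrightarrow> nbrs g \<subseteq> firsts \<union> rest"
proof -
  assume p: "p \<in> firsts"
  have "y \<notin> firsts" if "y \<in> nbrs p" for y
  proof
    assume "y \<in> firsts"
    then have "p \<in> seconds \<or> y \<in> seconds"
      using that p linkD(2) by (auto simp: nbrs_def elim!: firstsE)
    then show False using \<open>y \<in> firsts\<close> p firsts_seconds_disjoint by blast
  qed
  then show "nbrs p \<subseteq> seconds \<union> rest" using nbrs_sub by (auto simp: rest_def)
next
  assume g: "g \<in> seconds"
  have "y \<notin> seconds" if "y \<in> nbrs g" for y
  proof
    assume "y \<in> seconds"
    then have "g \<in> firsts \<or> y \<in> firsts"
      using that g linkD(3) by (auto simp: nbrs_def elim!: secondsE)
    then show False using \<open>y \<in> seconds\<close> g firsts_seconds_disjoint by blast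
  qed
  then show "nbrs g \<subseteq> firsts \<union> rest" using nbrs_sub by (auto simp: rest_def)
qed

text \<open>Otherwise a first vertex has neighbours only among the second vertices, which are half
  of \<open>V\<close>: too few.\<close>

lemma rest_nonempty: "rest \<noteq> {}"
proof
  assume r: "rest = {}"
  obtain p g where pg: "link p g" using links_nonempty by (auto simp: links_def)
  have "finite seconds" using firsts_seconds_sub finite_V finite_subset by auto
  then have "card (nbrs p) \<le> card seconds"
    using nbrs_first[OF linkD(4)[OF pg]] r by (auto intro: card_mono)
  then show False using degree_V[OF linkD(6)[OF pg]] card_rest r by (simp add: card_seconds)
qed

text \<open>The only arc leaving \<open>p\<close> and the only arc entering \<open>g\<close> belong
  to links and avoid \<open>rest\<close>, which fixes the direction of the arcs at \<open>y\<close>.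
  Common neighbours in \<open>rest\<close> thus give paths from \<open>g\<close> to
  \<open>p\<close>.\<close>

lemma through_rest:
  assumes "p \<in> firsts" "g \<in> seconds" "y \<in> rest" "y \<in> nbrs p" "y \<in> nbrs g"
  shows "(g, y) \<in> E" "(y, p) \<in> E"
proof -
  obtain b where b: "link p b" "b \<in> seconds" using assms(1) by (rule firstsE)
  obtain a where a: "link a g" "a \<in> firsts" using assms(2) by (rule secondsE)
  have "(p, y) \<notin> E" using linkD(2)[OF b(1)] b(2) assms(3) by (auto simp: rest_def)
  then show "(y, p) \<in> E" using assms(4) by (simp add: nbrs_def)
  have "(y, g) \<notin> E" using linkD(3)[OF a(1)] a(2) assms(3) by (auto simp: rest_def)
  then show "(g, y) \<in> E" using assms(5) by (simp add: nbrs_def)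
qed

text \<open>The two degrees add up to at least \<open>card V + 1\<close>. By inclusion-exclusion,
  their parts in \<open>rest\<close> contribute at most \<open>card rest\<close> plus the number of
  common neighbours there, and \<open>card V - card rest = 2 * card firsts\<close>.\<close>

lemma card_common_nbrs:
  assumes p: "p \<in> firsts" and g: "g \<in> seconds"
  shows "card (nbrs p \<inter> seconds) + card (nbrs g \<inter> firsts) + card (nbrs p \<inter> nbrs g \<inter> rest)
    \<ge> 2 * card firsts + 1"
proof -
  have fin: "finite rest" using finite_V by (simp add: rest_def)
  have "nbrs p = (nbrs p \<inter> seconds) \<union> (nbrs p \<inter> rest)" using nbrs_first[OF p] by auto
  then have "card (nbrs p) \<le> card (nbrs p \<inter> seconds) + card (nbrs p \<inter> rest)"
    using card_Un_le by metis
  moreover have "nbrs g = (nbrs g \<inter> firsts) \<union> (nbrs g \<inter> rest)" using nbrs_second[OF g] by auto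
  then have "card (nbrs g) \<le> card (nbrs g \<inter> firsts) + card (nbrs g \<inter> rest)"
    using card_Un_le by metis
  moreover have "card (nbrs p \<inter> rest) + card (nbrs g \<inter> rest)
      = card ((nbrs p \<inter> rest) \<union> (nbrs g \<inter> rest)) + card ((nbrs p \<inter> rest) \<inter> (nbrs g \<inter> rest))"
    using fin by (intro card_Un_Int) auto
  moreover have "card ((nbrs p \<inter> rest) \<inter> (nbrs g \<inter> rest)) = card (nbrs p \<inter> nbrs g \<inter> rest)"
    by (rule arg_cong[of _ _ card]) auto
  moreover have "card ((nbrs p \<inter> rest) \<union> (nbrs g \<inter> rest)) \<le> card rest"
    using fin by (intro card_mono) auto
  moreover have "card V + 1 \<le> 2 * card (nbrs p)" "card V + 1 \<le> 2 * card (nbrs g)"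
    using degree_V p g firsts_seconds_sub by auto
  ultimately show ?thesis using card_rest by linarith
qed

section \<open>A proper strong set containing all links\<close>

text \<open>Links already lead from first to second vertices, so paths from second to first vertices
  suffice; each vertex of \<open>Y\<close> lies on such a path of length two.\<close>

lemma strong_set_links:
  assumes Y: "\<And>y. y \<in> Y \<Longrightarrow> \<exists>g\<in>seconds. \<exists>p\<in>firsts. (g, y) \<in> E \<and> (y, p) \<in> E"
    and conn: "\<And>g p. g \<in> seconds \<Longrightarrow> p \<in> firsts \<Longrightarrow>
      (g, p) \<in> (Restr E (firsts \<union> seconds \<union> Y))\<^sup>*" (is "\<And>g p. _ \<Longrightarrow> _ \<Longrightarrow> _ \<in> ?R\<^sup>*")
  shows "strong_set E (firsts \<union> seconds \<union> Y)"
proof -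
  obtain p0 g0 where l0: "link p0 g0" using links_nonempty by (auto simp: links_def)
  have step: "(p, g) \<in> ?R" if "link p g" for p g using linkD(1,4,5)[OF that] by auto
  have second: "(g, g') \<in> ?R\<^sup>*" if g: "g \<in> seconds" and g': "g' \<in> seconds" for g g'
  proof -
    obtain a where "link a g'" "a \<in> firsts" using g' by (rule secondsE)
    then show ?thesis using conn[OF g] step by (blast intro: rtrancl_into_rtrancl)
  qed
  have first: "(p, g) \<in> ?R\<^sup>*" if p: "p \<in> firsts" and g: "g \<in> seconds" for p g
  proof -
    obtain b where "link p b" "b \<in> seconds" using p by (rule firstsE)
    then show ?thesis using second[OF _ g] step by (blast intro: converse_rtrancl_into_rtrancl)
  qed
  show ?thesis
  proof (rule strong_setI[where r = g0])
    fix u assume u: "u \<in> firsts \<union> seconds \<union> Y"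
    have g0: "g0 \<in> seconds" using linkD(5)[OF l0] .
    consider "u \<in> firsts" | "u \<in> seconds" | g p where "u \<in> Y" "g \<in> seconds" "p \<in> firsts" "(g, u) \<in> E" "(u, p) \<in> E"
      using u Y by blast
    then have "(u, g0) \<in> ?R\<^sup>* \<and> (g0, u) \<in> ?R\<^sup>*"
    proof cases
      case 3
      then have "(g, u) \<in> ?R" "(u, p) \<in> ?R" by auto
      then show ?thesis using second[OF g0 3(2)] first[OF 3(3) g0]
        by (meson rtrancl_into_rtrancl converse_rtrancl_into_rtrancl)
    qed (use first second conn g0 in auto)
    then show "(u, g0) \<in> ?R\<^sup>*" "(g0, u) \<in> ?R\<^sup>*" by auto
  qed
qed

lemma proper_strong_links: "\<exists>S. strong_set E S \<and> firsts \<union> seconds \<subseteq> S \<and> S \<subset> V"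
proof (cases "card firsts = 1")
  case True
  obtain p g where l: "link p g" using links_nonempty by (auto simp: links_def)
  have pg: "firsts = {p}" "seconds = {g}"
    using True linkD(4,5)[OF l] card_seconds by (auto simp: card_1_singleton_iff)
  \<comment> \<open>The total count is at least 3, so a common neighbour \<open>y\<close> in
    \<open>rest\<close> remains and closes a triangle with the link.\<close>
  have "card (nbrs p \<inter> {g}) \<le> 1" "card (nbrs g \<inter> {p}) \<le> 1"
    using card_mono[of "{g}" "nbrs p \<inter> {g}"] card_mono[of "{p}" "nbrs g \<inter> {p}"] by auto
  then have "card (nbrs p \<inter> nbrs g \<inter> rest) \<noteq> 0"
    using card_common_nbrs[of p g] pg by auto
  then obtain y where y: "y \<in> nbrs p" "y \<in> nbrs g" "y \<in> rest"
    by (metis Int_iff all_not_in_conv card.empty)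
  then have E: "(g, y) \<in> E" "(y, p) \<in> E" using through_rest pg by auto
  let ?S = "firsts \<union> seconds \<union> {y}"
  have "(g, y) \<in> Restr E ?S" "(y, p) \<in> Restr E ?S" using E pg by auto
  then have "(g, p) \<in> (Restr E ?S)\<^sup>*" by (meson r_into_rtrancl rtrancl_into_rtrancl)
  then have "strong_set E ?S" using E pg by (intro strong_set_links) auto
  moreover have "?S \<subseteq> V" using y firsts_seconds_sub by (auto simp: rest_def)
  moreover have "card ?S \<le> 3" by (simp add: pg card_insert_if)
  then have "?S \<noteq> V" using card_V by auto
  ultimately show ?thesis by blast
next
  case False
  \<comment> \<open>Leaving out \<open>x\<close> keeps the set proper; \<open>Y\<close> collects all
    other vertices that can carry a path from a second to a first vertex.\<close>
  obtain x where x: "x \<in> rest" using rest_nonempty by auto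
  define Y where "Y = {y \<in> rest - {x}. \<exists>g\<in>seconds. \<exists>p\<in>firsts. (g, y) \<in> E \<and> (y, p) \<in> E}"
  let ?S = "firsts \<union> seconds \<union> Y"
  have fin: "finite firsts" "finite seconds" using firsts_seconds_sub finite_V finite_subset by auto
  have unlinked: "(g, p) \<in> (Restr E ?S)\<^sup>*" if g: "g \<in> seconds" and p: "p \<in> firsts" and n: "\<not> link p g" for g p
  proof (cases "(g, p) \<in> E")
    case False
    moreover have "(p, g) \<notin> E"
    proof
      assume "(p, g) \<in> E"
      moreover obtain b where "link p b" using p by (rule firstsE)
      ultimately show False using linkD(2) n by blast
    qed
    ultimately have "nbrs p \<inter> seconds \<subseteq> seconds - {g}" "nbrs g \<inter> firsts \<subseteq> firsts - {p}"
      by (auto simp: nbrs_def)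
    \<comment> \<open>As \<open>p\<close> and \<open>g\<close> are not adjacent, both counts lose
      one, which leaves three common neighbours in \<open>rest\<close>, at least two of them other
      than \<open>x\<close>.\<close>
    then have "card (nbrs p \<inter> seconds) \<le> card firsts - 1" "card (nbrs g \<inter> firsts) \<le> card firsts - 1"
      using card_mono[of "seconds - {g}"] card_mono[of "firsts - {p}"] fin p g card_seconds by fastforce+
    moreover have "card firsts > 0" using fin p by (auto simp: card_gt_0_iff)
    ultimately have "card (nbrs p \<inter> nbrs g \<inter> rest) \<ge> 3" using card_common_nbrs[OF p g] by linarith
    then have "\<not> nbrs p \<inter> nbrs g \<inter> rest \<subseteq> {x}"
      using card_mono[of "{x}" "nbrs p \<inter> nbrs g \<inter> rest"] by auto
    then obtain y where y: "y \<in> nbrs p" "y \<in> nbrs g" "y \<in> rest" "y \<noteq> x" by blast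
    then have "(g, y) \<in> E" "(y, p) \<in> E" using through_rest p g by auto
    then have "(g, y) \<in> Restr E ?S" "(y, p) \<in> Restr E ?S" using y p g by (auto simp: Y_def)
    then show ?thesis by (meson r_into_rtrancl rtrancl_into_rtrancl)
  qed (use g p in auto)
  have "(g, p) \<in> (Restr E ?S)\<^sup>*" if g: "g \<in> seconds" and p: "p \<in> firsts" for g p
  proof (cases "link p g")
    case True
    have "card firsts \<ge> 2" using False fin p by (metis One_nat_def card_0_eq empty_iff less_2_cases not_less)
    then have "\<not> firsts \<subseteq> {p}" using card_mono[of "{p}" firsts] by auto
    \<comment> \<open>To return from \<open>g\<close> to its own partner \<open>p\<close>, the path
      makes a detour through another link.\<close>
    then obtain p' where p': "p' \<in> firsts" "p' \<noteq> p" by auto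
    then obtain g' where g': "link p' g'" "g' \<in> seconds" by (auto elim: firstsE)
    have "\<not> link p' g" "\<not> link p g'"
      using p' linkD(1)[OF True] linkD(1)[OF g'(1)] linkD(3) by blast+
    then have "(g, p') \<in> (Restr E ?S)\<^sup>*" "(g', p) \<in> (Restr E ?S)\<^sup>*" using unlinked g p p' g' by auto
    moreover have "(p', g') \<in> Restr E ?S" using linkD(1)[OF g'(1)] p' g' by auto
    ultimately show ?thesis by (meson rtrancl_into_rtrancl rtrancl_trans)
  qed (use unlinked g p in auto)
  then have "strong_set E ?S" by (intro strong_set_links) (auto simp: Y_def)
  moreover have "?S \<subseteq> V - {x}" using firsts_seconds_sub x by (auto simp: Y_def rest_def)
  moreover have "x \<in> V" using x by (simp add: rest_def)
  ultimately show ?thesis by blast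
qed

section \<open>The final contradiction\<close>

theorem contradiction: False
proof -
  obtain S where S: "strong_set E S" "firsts \<union> seconds \<subseteq> S" "S \<subset> V" using proper_strong_links by blast
  obtain p g where l: "link p g" using links_nonempty by (auto simp: links_def)
  then have "S \<noteq> {}" using linkD(4)[OF l] S(2) by auto
  then obtain H where H: "maximal_strong H" "S \<subseteq> H"
    using maximal_strong_extend[OF S(1) _ S(3)] by auto
  have pg: "p \<in> H" "g \<in> H" "g \<in> V" using linkD(4,5,7)[OF l] S H by auto
  \<comment> \<open>Only the first vertex of the return path can be entered from \<open>H\<close>;
    it serves as \<open>c\<close>.\<close>
  obtain c where c: "\<And>y. y \<in> V - H \<Longrightarrow> (g, y) \<in> E \<Longrightarrow> y = c"
  proof -
    obtain q m where "return_path H q m" using maximal_strong_complement[OF H(1)] by blast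
    note q = return_pathD[OF this]
    show thesis
    proof (rule that[of "q 1"])
      fix y assume y: "y \<in> V - H" "(g, y) \<in> E"
      then obtain i where "i \<in> {1..m}" "y = q i" unfolding q(3) by auto
      then show "y = q 1" using q(6)[of i g] pg y by auto
    qed
  qed
  \<comment> \<open>Arcs into \<open>g\<close> come only from \<open>p\<close>, which lies in
    \<open>H\<close>, so a neighbour outside \<open>H\<close> must be an out-neighbour, that is,
    \<open>c\<close>.\<close>
  have sub: "insert g (nbrs g - {c}) \<subseteq> H"
  proof -
    have "y \<in> H" if "y \<in> nbrs g" "y \<noteq> c" for y
    proof (rule ccontr)
      assume "y \<notin> H"
      then have "(y, g) \<notin> E" using linkD(3)[OF l, of y] pg by auto
      then show False using that c[of y] \<open>y \<notin> H\<close> nbrs_sub[of g] by (auto simp: nbrs_def)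
    qed
    then show ?thesis using pg by auto
  qed
  have "finite H" using H finite_V by (auto simp: maximal_strong_def intro: finite_subset)
  then have "card (insert g (nbrs g - {c})) \<le> card H" using sub by (rule card_mono)
  moreover have "card (insert g (nbrs g - {c})) = Suc (card (nbrs g - {c}))"
    using finite_nbrs nbrs_sub by (intro card_insert_disjoint) auto
  moreover have "card (nbrs g) \<le> Suc (card (nbrs g - {c}))"
    using finite_nbrs by (metis card_Suc_Diff1 card_Diff_singleton_if le_SucI order_refl)
  \<comment> \<open>Adding \<open>g\<close> makes up for the possible loss of \<open>c\<close>, so
    \<open>card H\<close> is at least the degree of \<open>g\<close>.\<close>
  ultimately have "card V \<le> 2 * card H + 2" using degree_V[OF pg(3)] by linarith
  then obtain a b where ab: "link a b" "a \<notin> H" using link_outside[OF H(1)] by auto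
  then show False using linkD(4)[OF ab(1)] S(2) H(2) by auto
qed

end

section \<open>Transfer to digraphs\<close>

lemma (in wf_digraph) strongly_connected_iff_strong_set:
  "strongly_connected G \<longleftrightarrow> verts G \<noteq> {} \<and> strong_set (arcs_ends G) (verts G)"
proof -
  have "Restr (arcs_ends G) (verts G) = arcs_ends G" by (auto simp: adj_in_verts)
  then show ?thesis
    by (auto simp: strongly_connected_def strong_set_def reachable_conv)
qed

lemma arcs_ends_del_vert:
  "arcs_ends (pre_digraph.del_vert G v) = {(x, y) \<in> arcs_ends G. x \<noteq> v \<and> y \<noteq> v}"
  by (auto simp: arcs_ends_conv pre_digraph.del_vert_def)

theorem corollary1:
  fixes D :: "('a, 'b) pre_digraph" and n :: nat
  assumes "digraph D"
    and "strongly_connected D"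
    and "card (verts D) = n"
    and "n \<ge> 4"
    and "\<And>x. x \<in> verts D \<Longrightarrow> real (degree D x) \<ge> (real n + 1) / 2"
  shows "\<exists>v. noncritical D v"
proof (rule ccontr)
  assume none: "\<nexists>v. noncritical D v"
  interpret digraph D by (rule assms(1))
  interpret R: strong_relation "verts D" "arcs_ends D"
    using assms(2) adj_in_verts adj_not_same
    by unfold_locales (auto simp: strongly_connected_iff_strong_set)
  interpret critical_relation "verts D" "arcs_ends D"
  proof
    show "4 \<le> card (verts D)" using assms by simp
  next
    fix x assume x: "x \<in> verts D"
    have "{y. adjacent D x y} = R.nbrs x"
      using x adj_in_verts adj_not_same by (auto simp: adjacent_def R.nbrs_def)
    then show "card (verts D) + 1 \<le> 2 * card (R.nbrs x)"
      using assms(5)[OF x] assms(3) by (simp add: degree_def)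
  next
    fix v assume v: "v \<in> verts D"
    interpret D': wf_digraph "del_vert v" by (rule wf_digraph_del_vert)
    have eq: "Restr (arcs_ends (del_vert v)) (verts D - {v}) = Restr (arcs_ends D) (verts D - {v})"
      by (auto simp: arcs_ends_del_vert)
    \<comment> \<open>\<open>strongly_connected\<close> also fails for an empty vertex set; this
      case has to be excluded before the failure can be blamed on reachability.\<close>
    have "\<not> verts D \<subseteq> {v}" using assms(3,4) card_mono[of "{v}" "verts D"] by auto
    moreover have "\<not> strongly_connected (del_vert v)"
      using none v assms(2) by (simp add: noncritical_def)
    ultimately show "\<not> strong_set (arcs_ends D) (verts D - {v})"
      unfolding D'.strongly_connected_iff_strong_set verts_del_vert strong_set_def eq by blast
  qed
  show False by (rule contradiction)
qed

end
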